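(* Let $m\geq2$, let $\mathbf{m}=m(m-1)\cdots21$ be the decreasing permutation of length $m$, and write $c=\cos\left(\frac{\pi}{m+1}\right)$. Then as $n\to\infty$, $$\mathbb{E}^{\mathbf m}(L_n)\sim \frac{\sum_{j=1}^{m-1}U_j^2(c)}{2^{m+1}c^3\,U_{m-1}(c)\prod_{j=2}^{m-1}\left(c-\cos\left(\frac{j\pi}{m+1}\right)\right)}\,n.$$
   Context: $S_n(312,\tau)$ is the set of permutations of $[n]$ avoiding both patterns $312$ and $\tau$. $L_n(\sigma)$ is the length of a longest increasing subsequence of $\sigma$, and $\mathbb{E}^{\tau}$ denotes expectation under the uniform distribution on $S_n(312,\tau)$. $U_j$ is the Chebyshev polynomial of the second kind: $U_0(t)=1$, $U_1(t)=2t$, $U_j(t)=2tU_{j-1}(t)-U_{j-2}(t)$. An empty product equals $1$. $a_n\sim b_n$ means $a_n/b_n\to1$. *)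

theory Defs
  imports "HOL-Probability.Probability" "HOL-Combinatorics.Combinatorics"
    "HOL-Library.Sublist" "HOL-Library.Landau_Symbols"
begin

text \<open>
  A permutation of [n] is represented by its one-line notation: a list in
  \<open>permutations_of_set {1..n}\<close>.  The order \<open>subseq\<close> from
  \<open>HOL-Library.Sublist\<close> ranges over not necessarily contiguous subsequences.
\<close>

definition order_isomorphic :: "nat list \<Rightarrow> nat list \<Rightarrow> bool" where
  "order_isomorphic xs ys \<longleftrightarrow>
     length xs = length ys \<and>
     (\<forall>i<length xs. \<forall>j<length xs. xs ! i < xs ! j \<longleftrightarrow> ys ! i < ys ! j)"

definition contains_pattern :: "nat list \<Rightarrow> nat list \<Rightarrow> bool" where
  "contains_pattern \<sigma> \<tau> \<longleftrightarrow> (\<exists>\<rho>. subseq \<rho> \<sigma> \<and> order_isomorphic \<rho> \<tau>)"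

definition avoiders :: "nat \<Rightarrow> nat list set \<Rightarrow> nat list set" where
  "avoiders n T = {\<sigma> \<in> permutations_of_set {1..n}. \<forall>\<tau>\<in>T. \<not> contains_pattern \<sigma> \<tau>}"

definition lis_length :: "nat list \<Rightarrow> nat" where
  "lis_length \<sigma> = Max {length \<rho> | \<rho>. subseq \<rho> \<sigma> \<and> sorted_wrt (<) \<rho>}"

text \<open>
  The uniform distribution \<open>pmf_of_set\<close> is meaningful only on a finite nonempty set.  Both hold
  below: the identity avoids 312 and every decreasing pattern of length at least 2.
\<close>

definition expected_lis :: "nat list \<Rightarrow> nat \<Rightarrow> real" where
  "expected_lis \<tau> n =
     measure_pmf.expectation (pmf_of_set (avoiders n {[3, 1, 2], \<tau>})) (\<lambda>\<sigma>. real (lis_length \<sigma>))"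

definition decreasing_perm :: "nat \<Rightarrow> nat list" where
  "decreasing_perm m = rev [1..<m + 1]"

fun chebyshev_U :: "nat \<Rightarrow> real \<Rightarrow> real" where
  "chebyshev_U 0 t = 1"
| "chebyshev_U (Suc 0) t = 2 * t"
| "chebyshev_U (Suc (Suc j)) t = 2 * t * chebyshev_U (Suc j) t - chebyshev_U j t"

end

theory Submission
  imports Defs
begin

text \<open>
  Splitting a 312-avoiding permutation at its minimum as \<open>l @ [min] @ r\<close> forces every entry of
  \<open>l\<close> below every entry of \<open>r\<close>, so these permutations are binary trees; the longest increasing
  subsequence has length \<open>max(L l, 1) + L r\<close> and the longest decreasing one
  \<open>max(D l + 1, D r)\<close>.  Bounding \<open>D\<close> by \<open>k\<close>, the generating functions \<open>C\<^sub>k\<close> of the number of trees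
  and \<open>B\<^sub>k\<close> of the sum of \<open>L\<close> satisfy
  \<open>C\<^sub>k = 1 + x C\<^sub>k\<^sub>-\<^sub>1 C\<^sub>k\<close> and \<open>B\<^sub>k = x (B\<^sub>k\<^sub>-\<^sub>1 + 1) C\<^sub>k\<^sup>2\<close>.
  Hence \<open>C\<^sub>k = P\<^sub>k / P\<^sub>k\<^sub>+\<^sub>1\<close> and
  \<open>B\<^sub>k = (\<Sum>j=1..k. x\<^sup>k\<^sup>+\<^sup>1\<^sup>-\<^sup>j P\<^sub>j\<^sup>2) / P\<^sub>k\<^sub>+\<^sub>1\<^sup>2\<close> for the rescaled Chebyshev polynomials
  \<open>P\<^sub>j(x) = x\<^sup>j\<^sup>/\<^sup>2 U\<^sub>j(1 / (2\<surd>x))\<close>.  The zeros of \<open>P\<^sub>m\<close> are \<open>1 / (4 cos\<^sup>2(j\<pi>/(m+1)))\<close>,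
  so the smallest one, \<open>1 / (4c\<^sup>2)\<close>, is a simple pole of \<open>C\<^sub>m\<^sub>-\<^sub>1\<close> and a double pole of \<open>B\<^sub>m\<^sub>-\<^sub>1\<close>.
  The coefficients of such series are partial sums (respectively sums of partial sums) of a
  series that still converges at the pole, which gives the asymptotics of both without any
  complex analysis.
\<close>

unbundle no vec_syntax
unbundle fps_syntax

section \<open>312-avoiding permutations as binary trees\<close>

datatype btree = Lf | Nd btree btree

text \<open>The in-order reading of \<open>t\<close> with labels from \<open>a\<close> on: the root
  carries the minimum and the left subtree the next \<open>size l\<close> labels, so all labels on
  the left lie below those on the right. \<open>size\<close> counts the inner nodes.\<close>

primrec tree_perm :: "btree \<Rightarrow> nat \<Rightarrow> nat list" where
  "tree_perm Lf a = []"
| "tree_perm (Nd l r) a = tree_perm l (Suc a) @ a # tree_perm r (Suc a + size l)"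

primrec inc_len :: "btree \<Rightarrow> nat" where
  "inc_len Lf = 0"
| "inc_len (Nd l r) = max (inc_len l) 1 + inc_len r"

primrec dec_len :: "btree \<Rightarrow> nat" where
  "dec_len Lf = 0"
| "dec_len (Nd l r) = max (Suc (dec_len l)) (dec_len r)"

definition avoids_312 :: "nat list \<Rightarrow> bool" where
  "avoids_312 \<sigma> \<longleftrightarrow> (\<forall>x y z. subseq [x, y, z] \<sigma> \<longrightarrow> y < z \<longrightarrow> z < x \<longrightarrow> False)"

lemma set_tree_perm: "set (tree_perm t a) = {a..<a + size t}"
  by (induction t arbitrary: a) auto

lemma length_tree_perm [simp]: "length (tree_perm t a) = size t"
  by (induction t arbitrary: a) auto

lemma distinct_tree_perm: "distinct (tree_perm t a)"
  by (induction t arbitrary: a) (auto simp: set_tree_perm)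

lemma append_Cons_eq_append_Cons_unique:
  assumes "xs @ a # ys = xs' @ a # ys'" "a \<notin> set xs" "a \<notin> set xs'"
  shows "xs = xs' \<and> ys = ys'"
  using assms by (induction xs arbitrary: xs') (auto simp: Cons_eq_append_conv)

lemma tree_perm_inj: "tree_perm t a = tree_perm t' a \<Longrightarrow> t = t'"
proof (induction t arbitrary: t' a)
  case Lf
  then show ?case by (cases t') auto
next
  case (Nd l r)
  then obtain l' r' where t': "t' = Nd l' r'" by (cases t') auto
  have *: "tree_perm l (Suc a) = tree_perm l' (Suc a) \<and>
    tree_perm r (Suc a + size l) = tree_perm r' (Suc a + size l')"
    by (rule append_Cons_eq_append_Cons_unique[where a = a])
       (use Nd.prems in \<open>auto simp: t' set_tree_perm\<close>)
  \<comment> \<open>The offset of the right part contains \<open>size l\<close>, so the left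
    subtrees must be identified before the right ones can be compared.\<close>
  then have "l = l'" using Nd.IH(1) by blast
  with * Nd.IH(2) t' show ?case by auto
qed

lemma subseq_set: "subseq xs ys \<Longrightarrow> set xs \<subseteq> set ys"
  by (metis set_nths_subset subseq_conv_nths)

text \<open>A subsequence splits along the root. The upper bounds on lengths and the proof of
  avoidance both start from this decomposition.\<close>

lemma subseq_append_ConsE:
  assumes "subseq \<rho> (xs @ a # ys)"
  obtains \<alpha> \<beta> \<gamma> where "\<rho> = \<alpha> @ \<beta> @ \<gamma>" "subseq \<alpha> xs" "\<beta> = [] \<or> \<beta> = [a]" "subseq \<gamma> ys"
proof -
  from assms obtain \<alpha> \<delta> where 1: "\<rho> = \<alpha> @ \<delta>" "subseq \<alpha> xs" "subseq \<delta> (a # ys)"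
    by (auto simp: subseq_append_iff)
  have "\<exists>\<beta> \<gamma>. \<delta> = \<beta> @ \<gamma> \<and> (\<beta> = [] \<or> \<beta> = [a]) \<and> subseq \<gamma> ys"
  proof (cases "subseq \<delta> ys")
    case False
    with 1(3) obtain \<gamma> where "\<delta> = a # \<gamma>" "subseq \<gamma> ys"
      by (cases \<delta>) (auto split: if_splits elim: list_emb.cases)
    then show ?thesis by (intro exI[of _ "[a]"] exI[of _ \<gamma>]) auto
  qed auto
  with 1 that show thesis by blast
qed

section \<open>Longest monotone subsequences of a tree permutation\<close>

lemma inc_len_pos: "t \<noteq> Lf \<Longrightarrow> inc_len t \<ge> 1"
  by (cases t) auto

text \<open>Optimal choices on the two sides can be concatenated, since left labels lie below right
  ones. The root is used only when the left subtree is empty; otherwise the left side already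
  contributes at least one entry.\<close>

lemma inc_subseq_exists:
  "\<exists>\<rho>. subseq \<rho> (tree_perm t a) \<and> sorted_wrt (<) \<rho> \<and> length \<rho> = inc_len t"
proof (induction t arbitrary: a)
  case (Nd l r)
  obtain \<rho>1 where 1: "subseq \<rho>1 (tree_perm l (Suc a))" "sorted_wrt (<) \<rho>1" "length \<rho>1 = inc_len l"
    using Nd.IH(1) by blast
  obtain \<rho>2 where 2: "subseq \<rho>2 (tree_perm r (Suc a + size l))" "sorted_wrt (<) \<rho>2"
      "length \<rho>2 = inc_len r"
    using Nd.IH(2) by blast
  have s2: "set \<rho>2 \<subseteq> {Suc a + size l..}" using subseq_set[OF 2(1)] by (auto simp: set_tree_perm)
  show ?case
  proof (cases "l = Lf")
    case True
    then show ?thesis using 2 s2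
      by (intro exI[of _ "a # \<rho>2"]) auto
  next
    case False
    have "set \<rho>1 \<subseteq> {..<Suc a + size l}"
      using subseq_set[OF 1(1)] by (auto simp: set_tree_perm)
    with 1 2 s2 inc_len_pos[OF False] show ?thesis
      by (intro exI[of _ "\<rho>1 @ \<rho>2"])
         (fastforce simp: sorted_wrt_append intro!: list_emb_append_mono)
  qed
qed auto

text \<open>The root follows the left part and is smaller than all of it, so an increasing
  subsequence meets at most one of the two.\<close>

lemma inc_subseq_le:
  "subseq \<rho> (tree_perm t a) \<Longrightarrow> sorted_wrt (<) \<rho> \<Longrightarrow> length \<rho> \<le> inc_len t"
proof (induction t arbitrary: a \<rho>)
  case (Nd l r)
  from Nd.prems(1) obtain \<alpha> \<beta> \<gamma> where d: "\<rho> = \<alpha> @ \<beta> @ \<gamma>" "subseq \<alpha> (tree_perm l (Suc a))"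
    "\<beta> = [] \<or> \<beta> = [a]" "subseq \<gamma> (tree_perm r (Suc a + size l))"
    unfolding tree_perm.simps by (rule subseq_append_ConsE)
  have "length \<alpha> \<le> inc_len l" "length \<gamma> \<le> inc_len r"
    using Nd.IH d Nd.prems(2) by (auto simp: sorted_wrt_append)
  moreover have "\<alpha> = [] \<or> \<beta> = []"
    using subseq_set[OF d(2)] d(3) Nd.prems(2)
    by (cases \<alpha>) (auto simp: d(1) set_tree_perm sorted_wrt_append)
  ultimately show ?case using d(1,3) by auto
qed auto

lemma lis_length_tree_perm: "lis_length (tree_perm t a) = inc_len t"
proof -
  have "finite {length \<rho> |\<rho>. subseq \<rho> (tree_perm t a) \<and> sorted_wrt (<) \<rho>}"
    by (rule finite_subset[of _ "{..inc_len t}"]) (auto dest: inc_subseq_le)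
  then show ?thesis unfolding lis_length_def
  proof (rule Max_eqI)
    show "inc_len t \<in> {length \<rho> |\<rho>. subseq \<rho> (tree_perm t a) \<and> sorted_wrt (<) \<rho>}"
      using inc_subseq_exists[of t a] by (metis (mono_tags, lifting) mem_Collect_eq)
  qed (auto dest: inc_subseq_le)
qed

text \<open>The root can be appended to any decreasing subsequence of the left part; the alternative
  is to stay in the right part.\<close>

lemma dec_subseq_exists:
  "\<exists>\<rho>. subseq \<rho> (tree_perm t a) \<and> sorted_wrt (>) \<rho> \<and> length \<rho> = dec_len t"
proof (induction t arbitrary: a)
  case (Nd l r)
  obtain \<rho>1 where 1: "subseq \<rho>1 (tree_perm l (Suc a))" "sorted_wrt (>) \<rho>1" "length \<rho>1 = dec_len l"
    using Nd.IH(1) by blast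
  obtain \<rho>2 where 2: "subseq \<rho>2 (tree_perm r (Suc a + size l))" "sorted_wrt (>) \<rho>2"
      "length \<rho>2 = dec_len r"
    using Nd.IH(2) by blast
  have s1: "set \<rho>1 \<subseteq> {Suc a..}" using subseq_set[OF 1(1)] by (auto simp: set_tree_perm)
  show ?case
  proof (cases "Suc (dec_len l) \<le> dec_len r")
    case True
    then show ?thesis using 2
      by (intro exI[of _ \<rho>2]) auto
  next
    case False
    with 1 s1 show ?thesis
      by (intro exI[of _ "\<rho>1 @ [a]"])
         (fastforce simp: sorted_wrt_append intro!: list_emb_append_mono)
  qed
qed auto

text \<open>Entries of the right part exceed everything before them, so a decreasing subsequence
  that enters the right part lies entirely in it.\<close>

lemma dec_subseq_le:
  "subseq \<rho> (tree_perm t a) \<Longrightarrow> sorted_wrt (>) \<rho> \<Longrightarrow> length \<rho> \<le> dec_len t"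
proof (induction t arbitrary: a \<rho>)
  case (Nd l r)
  from Nd.prems(1) obtain \<alpha> \<beta> \<gamma> where d: "\<rho> = \<alpha> @ \<beta> @ \<gamma>" "subseq \<alpha> (tree_perm l (Suc a))"
    "\<beta> = [] \<or> \<beta> = [a]" "subseq \<gamma> (tree_perm r (Suc a + size l))"
    unfolding tree_perm.simps by (rule subseq_append_ConsE)
  have "length \<alpha> \<le> dec_len l" "length \<gamma> \<le> dec_len r"
    using Nd.IH d Nd.prems(2) by (auto simp: sorted_wrt_append)
  moreover have "\<alpha> @ \<beta> = [] \<or> \<gamma> = []"
    using subseq_set[OF d(2)] subseq_set[OF d(4)] d(3) Nd.prems(2)
    by (cases \<alpha>; cases \<gamma>) (auto simp: d(1) set_tree_perm sorted_wrt_append)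
  ultimately show ?case using d(1,3) by auto
qed auto

text \<open>Excluding the single length \<open>m\<close> is enough, because a longer decreasing
  subsequence can be truncated to its first \<open>m\<close> entries. This is the form in which
  pattern avoidance appears.\<close>

lemma dec_len_less_iff:
  "dec_len t < m \<longleftrightarrow> (\<forall>\<rho>. subseq \<rho> (tree_perm t a) \<longrightarrow> sorted_wrt (>) \<rho> \<longrightarrow> length \<rho> \<noteq> m)"
proof
  assume "dec_len t < m"
  then show "\<forall>\<rho>. subseq \<rho> (tree_perm t a) \<longrightarrow> sorted_wrt (>) \<rho> \<longrightarrow> length \<rho> \<noteq> m"
    using dec_subseq_le by fastforce
next
  assume *: "\<forall>\<rho>. subseq \<rho> (tree_perm t a) \<longrightarrow> sorted_wrt (>) \<rho> \<longrightarrow> length \<rho> \<noteq> m"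
  obtain \<rho> where \<rho>: "subseq \<rho> (tree_perm t a)" "sorted_wrt (>) \<rho>" "length \<rho> = dec_len t"
    using dec_subseq_exists by blast
  show "dec_len t < m"
  proof (rule ccontr)
    assume "\<not> dec_len t < m"
    then have "subseq (take m \<rho>) (tree_perm t a)" "length (take m \<rho>) = m"
      using \<rho> subseq_order.order_trans[of "take m \<rho>" \<rho>]
      by (auto intro: prefix_imp_subseq take_is_prefix)
    with * \<rho>(2) show False by (metis sorted_wrt_take)
  qed
qed

section \<open>Tree permutations are exactly the permutations avoiding 312\<close>

lemma avoids_312_subseq: "avoids_312 ys \<Longrightarrow> subseq xs ys \<Longrightarrow> avoids_312 xs"
  unfolding avoids_312_def by (meson subseq_order.order_trans)

text \<open>An occurrence inside one subtree is excluded by induction. Otherwise it starts at the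
  root, ends at the root, or runs from left to right: the root is too small to play 3 or 2, and a
  right entry is too large to play 2 after a left entry played 3.\<close>

lemma avoids_312_tree_perm: "avoids_312 (tree_perm t a)"
proof (induction t arbitrary: a)
  case (Nd l r)
  show ?case unfolding avoids_312_def
  proof (intro allI impI)
    fix x y z assume s: "subseq [x, y, z] (tree_perm (Nd l r) a)" and lt: "y < z" "z < x"
    from s obtain \<alpha> \<beta> \<gamma> where d: "[x, y, z] = \<alpha> @ \<beta> @ \<gamma>" "subseq \<alpha> (tree_perm l (Suc a))"
      "\<beta> = [] \<or> \<beta> = [a]" "subseq \<gamma> (tree_perm r (Suc a + size l))"
      unfolding tree_perm.simps by (rule subseq_append_ConsE)
    have \<alpha>: "\<forall>u\<in>set \<alpha>. a < u \<and> u < Suc a + size l"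
      using subseq_set[OF d(2)] by (auto simp: set_tree_perm)
    have \<gamma>: "\<forall>u\<in>set \<gamma>. Suc a + size l \<le> u"
      using subseq_set[OF d(4)] by (auto simp: set_tree_perm)
    have whole: "\<alpha> \<noteq> [x, y, z]" "\<gamma> \<noteq> [x, y, z]"
      using d(2,4) lt Nd.IH unfolding avoids_312_def by blast+
    show False
    proof (cases "\<alpha> = []")
      case True
      then show False using d(1,3) lt \<gamma> whole by auto
    next
      case False
      then have x: "x \<in> set \<alpha>" using d(1) by (cases \<alpha>) auto
      show False
      proof (cases \<gamma> rule: rev_cases)
        case Nil
        with d(1,3) whole have "\<alpha> @ [a] = [x, y] @ [z]" by auto
        then have "y \<in> set \<alpha>" "z = a" by (auto simp only: append1_eq_conv) simp
        then show False using \<alpha> lt by fastforce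
      next
        case (snoc \<gamma>' z')
        then have "(\<alpha> @ \<beta> @ \<gamma>') @ [z'] = [x, y] @ [z]" using d(1) by simp
        then have "z' = z" by (simp only: append1_eq_conv)
        then have "z \<in> set \<gamma>" using snoc by simp
        then show False using x \<alpha> \<gamma> lt by fastforce
      qed
    qed
  qed
qed (auto simp: avoids_312_def)

text \<open>Split at the minimum \<open>a\<close>. Avoidance puts the left values below the right
  ones, so both sides fill intervals and the induction hypothesis applies to each.\<close>

lemma avoids_312_imp_tree_perm:
  assumes "distinct \<sigma>" "set \<sigma> = {a..<a + length \<sigma>}" "avoids_312 \<sigma>"
  shows "\<exists>t. tree_perm t a = \<sigma>"
  using assms
proof (induction "length \<sigma>" arbitrary: \<sigma> a rule: less_induct)
  case less
  show ?case
  proof (cases "\<sigma> = []")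
    case True
    then show ?thesis by (intro exI[of _ Lf]) auto
  next
    case False
    then have "a \<in> set \<sigma>" using less.prems(2) by simp
    then obtain xs ys where \<sigma>: "\<sigma> = xs @ a # ys" by (meson split_list)
    have sets: "set xs \<union> set ys = {Suc a..<a + length \<sigma>}"
    proof -
      have "set xs \<union> set ys = set (xs @ a # ys) - {a}" using less.prems(1)[unfolded \<sigma>] by auto
      also have "\<dots> = {a..<a + length \<sigma>} - {a}" using less.prems(2) \<sigma> by metis
      also have "\<dots> = {Suc a..<a + length \<sigma>}" by auto
      finally show ?thesis .
    qed
    \<comment> \<open>If \<open>x > y\<close>, then \<open>x, a, y\<close> would be an occurrence of
      312.\<close>
    have lt: "x < y" if "x \<in> set xs" "y \<in> set ys" for x y
    proof -
      have "subseq ([x] @ [a] @ [y]) (xs @ [a] @ ys)"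
        using that by (intro list_emb_append_mono) (auto simp: subseq_singleton_left)
      then have "\<not> (a < y \<and> y < x)"
        using less.prems(3) unfolding avoids_312_def \<sigma> by auto
      moreover have "a < y" "x \<noteq> y" using that sets less.prems(1) \<sigma> by auto
      ultimately show ?thesis by linarith
    qed
    define b where "b = Suc a + length xs"
    have len: "length \<sigma> = Suc (length xs + length ys)" by (simp add: \<sigma>)
    have dist: "distinct xs" "distinct ys" "set xs \<inter> set ys = {}" using less.prems(1) \<sigma> by auto
    have xs: "set xs = {Suc a..<Suc a + length xs}"
    proof (rule card_subset_eq)
      show "set xs \<subseteq> {Suc a..<Suc a + length xs}"
      proof (rule ccontr)
        assume "\<not> set xs \<subseteq> {Suc a..<Suc a + length xs}"
        then obtain x where x: "x \<in> set xs" "x \<ge> b" using sets b_def by fastforce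
        \<comment> \<open>Had the left part a value \<open>x\<close> of at least \<open>b\<close>,
          the right part would have to fit above \<open>x\<close>, where only
          \<open>length ys - 1\<close> values are left at most;
          \<open>x < a + length \<sigma>\<close> excludes an empty right part.\<close>
        then have "set ys \<subseteq> {b<..<a + length \<sigma>}"
          using lt[OF x(1)] sets by force
        then have "card (set ys) \<le> card {b<..<a + length \<sigma>}" by (rule card_mono[rotated]) auto
        moreover have "x < a + length \<sigma>" using x(1) sets by auto
        ultimately show False using distinct_card[OF dist(2)] x(2)
          by (simp add: len b_def)
      qed
    qed (use dist in \<open>auto simp: distinct_card\<close>)
    have ys: "set ys = {b..<b + length ys}"
    proof -
      have "set ys = {Suc a..<a + length \<sigma>} - set xs" using sets dist(3) by auto
      also have "\<dots> = {b..<b + length ys}" unfolding xs by (auto simp: b_def len)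
      finally show ?thesis .
    qed
    have sub: "subseq xs \<sigma>" "subseq ys \<sigma>" by (auto simp: \<sigma>)
    obtain l where l: "tree_perm l (Suc a) = xs"
      using less.hyps[of xs "Suc a"] xs dist avoids_312_subseq[OF less.prems(3) sub(1)] len by auto
    obtain r where r: "tree_perm r b = ys"
      using less.hyps[of ys b] ys dist avoids_312_subseq[OF less.prems(3) sub(2)] len by auto
    have "size l = length xs" using l by auto
    then show ?thesis using l r by (intro exI[of _ "Nd l r"]) (simp add: \<sigma> b_def)
  qed
qed

section \<open>Translation of the two forbidden patterns\<close>

lemma contains_312_iff: "contains_pattern \<sigma> [3, 1, 2] \<longleftrightarrow> \<not> avoids_312 \<sigma>"
proof -
  have "order_isomorphic \<rho> [3, 1, 2] \<longleftrightarrow> (\<exists>x y z. \<rho> = [x, y, z] \<and> y < z \<and> z < x)" for \<rho>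
  proof
    assume *: "order_isomorphic \<rho> [3, 1, 2]"
    then have "length \<rho> = 3" by (simp add: order_isomorphic_def)
    then obtain x y z where \<rho>: "\<rho> = [x, y, z]"
      by (auto simp: length_Suc_conv numeral_3_eq_3)
    with * show "\<exists>x y z. \<rho> = [x, y, z] \<and> y < z \<and> z < x"
      by (auto simp: order_isomorphic_def All_less_Suc numeral_3_eq_3)
  next
    assume "\<exists>x y z. \<rho> = [x, y, z] \<and> y < z \<and> z < x"
    then obtain x y z where "\<rho> = [x, y, z]" "y < z" "z < x" by blast
    then show "order_isomorphic \<rho> [3, 1, 2]"
      by (simp add: order_isomorphic_def All_less_Suc)
  qed
  then show ?thesis
    unfolding contains_pattern_def avoids_312_def by auto
qed

lemma order_isomorphic_decreasing_perm:
  "order_isomorphic \<rho> (decreasing_perm m) \<longleftrightarrow> length \<rho> = m \<and> sorted_wrt (>) \<rho>"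
proof (cases "length \<rho> = m")
  case True
  have nth: "decreasing_perm m ! i = m - i" if "i < m" for i
    using that unfolding decreasing_perm_def by (subst rev_nth) (simp_all del: upt_Suc)
  have *: "order_isomorphic \<rho> (decreasing_perm m) \<longleftrightarrow>
    (\<forall>i<m. \<forall>j<m. \<rho> ! i < \<rho> ! j \<longleftrightarrow> j < i)"
    using True by (auto simp: order_isomorphic_def nth) (simp add: decreasing_perm_def del: upt_Suc)
  show ?thesis
  proof
    assume iso: "order_isomorphic \<rho> (decreasing_perm m)"
    then have "\<rho> ! j < \<rho> ! i" if "i < j" "j < m" for i j
      using that unfolding * by simp
    then show "length \<rho> = m \<and> sorted_wrt (>) \<rho>"
      using True by (simp add: sorted_wrt_iff_nth_less)
  next
    assume "length \<rho> = m \<and> sorted_wrt (>) \<rho>"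
    then have dec: "\<rho> ! j < \<rho> ! i" if "i < j" "j < m" for i j
      using that by (simp add: sorted_wrt_iff_nth_less)
    have "\<rho> ! i < \<rho> ! j \<longleftrightarrow> j < i" if "i < m" "j < m" for i j
      using dec[of i j] dec[of j i] that by (cases i j rule: linorder_cases) auto
    then show "order_isomorphic \<rho> (decreasing_perm m)" unfolding * by blast
  qed
qed (simp add: order_isomorphic_def decreasing_perm_def del: upt_Suc)

lemma contains_decreasing_iff:
  "contains_pattern \<sigma> (decreasing_perm m) \<longleftrightarrow>
    (\<exists>\<rho>. subseq \<rho> \<sigma> \<and> sorted_wrt (>) \<rho> \<and> length \<rho> = m)"
  by (auto simp: contains_pattern_def order_isomorphic_decreasing_perm)

definition bounded_trees :: "nat \<Rightarrow> nat \<Rightarrow> btree set" where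
  "bounded_trees k n = {t. size t = n \<and> dec_len t \<le> k}"

text \<open>Avoiding the decreasing pattern of length \<open>m\<close> means
  \<open>dec_len t < m\<close>, which is the bound \<open>m - 1\<close> because \<open>m\<close> is
  positive.\<close>

lemma avoiders_eq_trees:
  assumes "m \<ge> 1"
  shows "avoiders n {[3, 1, 2], decreasing_perm m} = (\<lambda>t. tree_perm t 1) ` bounded_trees (m - 1) n"
proof (intro set_eqI iffI)
  fix \<sigma> assume *: "\<sigma> \<in> avoiders n {[3, 1, 2], decreasing_perm m}"
  then have \<sigma>: "distinct \<sigma>" "set \<sigma> = {1..n}" "avoids_312 \<sigma>"
    by (auto simp: avoiders_def permutations_of_set_def contains_312_iff[unfolded One_nat_def])
  then have len: "length \<sigma> = n" using distinct_card[of \<sigma>] by simp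
  then obtain t where t: "tree_perm t 1 = \<sigma>"
    using avoids_312_imp_tree_perm[of \<sigma> 1] \<sigma> by (auto simp: atLeastLessThanSuc_atLeastAtMost)
  have "dec_len t < m" unfolding dec_len_less_iff[of t m 1] t
    using * by (auto simp: avoiders_def contains_decreasing_iff)
  with t len show "\<sigma> \<in> (\<lambda>t. tree_perm t 1) ` bounded_trees (m - 1) n"
    by (auto simp: bounded_trees_def)
next
  fix \<sigma> assume "\<sigma> \<in> (\<lambda>t. tree_perm t 1) ` bounded_trees (m - 1) n"
  then obtain t where t: "\<sigma> = tree_perm t 1" "size t = n" "dec_len t < m"
    using assms by (auto simp: bounded_trees_def)
  then show "\<sigma> \<in> avoiders n {[3, 1, 2], decreasing_perm m}"
    using avoids_312_tree_perm[of t 1] distinct_tree_perm[of t 1] dec_len_less_iff[of t m 1]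
    by (auto simp: avoiders_def permutations_of_set_def contains_312_iff[unfolded One_nat_def]
        set_tree_perm contains_decreasing_iff)
qed

section \<open>Recurrences for the counts and for the sums of lengths\<close>

definition tree_count :: "nat \<Rightarrow> nat \<Rightarrow> nat" where
  "tree_count k n = card (bounded_trees k n)"

definition tree_inc_sum :: "nat \<Rightarrow> nat \<Rightarrow> nat" where
  "tree_inc_sum k n = (\<Sum>t\<in>bounded_trees k n. inc_len t)"

lemma btree_size_eq_0: "size (t :: btree) = 0 \<Longrightarrow> t = Lf"
  by (cases t) auto

lemma bounded_trees_0: "bounded_trees k 0 = {Lf}"
  by (auto simp: bounded_trees_def intro: btree_size_eq_0)

lemma bounded_trees_0_Suc: "bounded_trees 0 (Suc n) = {}"
proof -
  have "dec_len t \<noteq> 0" if "size t = Suc n" for t using that by (cases t) auto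
  then show ?thesis by (auto simp: bounded_trees_def)
qed

text \<open>The root lengthens decreasing subsequences of the left subtree only, so the bound drops
  to \<open>k\<close> on the left and stays \<open>Suc k\<close> on the right.\<close>

lemma bounded_trees_Suc:
  "bounded_trees (Suc k) (Suc n) =
    (\<lambda>(l, r). Nd l r) ` (\<Union>i\<le>n. bounded_trees k i \<times> bounded_trees (Suc k) (n - i))"
proof (intro set_eqI iffI)
  fix t assume *: "t \<in> bounded_trees (Suc k) (Suc n)"
  then obtain l r where "t = Nd l r" by (cases t) (auto simp: bounded_trees_def)
  with * show "t \<in> (\<lambda>(l, r). Nd l r) ` (\<Union>i\<le>n. bounded_trees k i \<times> bounded_trees (Suc k) (n - i))"
    by (force simp: bounded_trees_def)
qed (auto simp: bounded_trees_def)

lemma finite_bounded_trees: "finite (bounded_trees k n)"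
proof (induction n arbitrary: k rule: less_induct)
  case (less n)
  show ?case
  proof (cases n)
    case 0
    then show ?thesis by (simp add: bounded_trees_0)
  next
    case (Suc n')
    show ?thesis
    proof (cases k)
      case 0
      then show ?thesis by (simp add: Suc bounded_trees_0_Suc)
    next
      case (Suc k')
      then show ?thesis using less \<open>n = Suc n'\<close> by (auto simp: bounded_trees_Suc)
    qed
  qed
qed

lemma sum_bounded_trees_Suc:
  "(\<Sum>t\<in>bounded_trees (Suc k) (Suc n). f t) =
    (\<Sum>i\<le>n. \<Sum>l\<in>bounded_trees k i. \<Sum>r\<in>bounded_trees (Suc k) (n - i). f (Nd l r))"
proof -
  have "(\<Sum>t\<in>bounded_trees (Suc k) (Suc n). f t) =
    (\<Sum>(l, r)\<in>(\<Union>i\<le>n. bounded_trees k i \<times> bounded_trees (Suc k) (n - i)). f (Nd l r))"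
    unfolding bounded_trees_Suc
    by (subst sum.reindex) (auto simp: inj_on_def case_prod_unfold)
  also have "\<dots> = (\<Sum>i\<le>n. \<Sum>(l, r)\<in>bounded_trees k i \<times> bounded_trees (Suc k) (n - i). f (Nd l r))"
    by (rule sum.UNION_disjoint)
       (auto simp: finite_bounded_trees, auto simp: bounded_trees_def)
  finally show ?thesis by (simp add: sum.cartesian_product)
qed

lemma tree_count_0: "tree_count k 0 = 1" "tree_count 0 (Suc n) = 0"
  by (simp_all add: tree_count_def bounded_trees_0 bounded_trees_0_Suc)

lemma tree_inc_sum_0: "tree_inc_sum k 0 = 0" "tree_inc_sum 0 n = 0"
  by (cases n; simp add: tree_inc_sum_def bounded_trees_0 bounded_trees_0_Suc)+

lemma tree_count_Suc:
  "tree_count (Suc k) (Suc n) = (\<Sum>i\<le>n. tree_count k i * tree_count (Suc k) (n - i))"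
  using sum_bounded_trees_Suc[of "\<lambda>_. 1::nat" k n] by (simp add: tree_count_def)

text \<open>The term \<open>of_bool (i = 0)\<close> accounts for the maximum with 1 in
  \<open>inc_len\<close>: it matters only for the empty left subtree, where the root itself is
  counted.\<close>

lemma tree_inc_sum_Suc:
  "tree_inc_sum (Suc k) (Suc n) =
    (\<Sum>i\<le>n. (tree_inc_sum k i + of_bool (i = 0)) * tree_count (Suc k) (n - i)
       + tree_count k i * tree_inc_sum (Suc k) (n - i))"
proof -
  have 1: "(\<Sum>l\<in>bounded_trees k i. max (inc_len l) 1) = tree_inc_sum k i + of_bool (i = 0)" for i
  proof (cases i)
    case 0
    then show ?thesis by (simp add: bounded_trees_0 tree_inc_sum_def)
  next
    case (Suc i')
    then have "(\<Sum>l\<in>bounded_trees k i. max (inc_len l) 1) = (\<Sum>l\<in>bounded_trees k i. inc_len l)"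
      by (intro sum.cong max_absorb1 inc_len_pos refl) (auto simp: bounded_trees_def)
    then show ?thesis by (simp add: Suc tree_inc_sum_def)
  qed
  show ?thesis
    unfolding 1[symmetric]
    by (simp add: tree_inc_sum_def[of "Suc k"] sum_bounded_trees_Suc sum.distrib
        tree_count_def sum_distrib_left sum_distrib_right mult_ac)
qed

lemma bounded_trees_nonempty: "bounded_trees (Suc k) n \<noteq> {}"
proof (induction n)
  case (Suc n)
  then obtain r where "size r = n" "dec_len r \<le> Suc k" by (auto simp: bounded_trees_def)
  then have "Nd Lf r \<in> bounded_trees (Suc k) (Suc n)" by (simp add: bounded_trees_def)
  then show ?case by blast
qed (simp add: bounded_trees_0)

lemma expected_lis_eq:
  assumes "m \<ge> 2"
  shows "expected_lis (decreasing_perm m) n =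
    real (tree_inc_sum (m - 1) n) / real (tree_count (m - 1) n)"
proof -
  let ?T = "bounded_trees (m - 1) n" and ?p = "\<lambda>t. tree_perm t 1"
  let ?A = "avoiders n {[3, 1, 2], decreasing_perm m}"
  have inj: "inj_on ?p ?T" by (auto simp: inj_on_def dest: tree_perm_inj)
  have A: "?A = ?p ` ?T" by (rule avoiders_eq_trees) (use assms in simp)
  have "finite ?A" unfolding A by (intro finite_imageI finite_bounded_trees)
  moreover have "?A \<noteq> {}"
    using bounded_trees_nonempty[of "m - 2" n] assms unfolding A
    by (simp add: Suc_diff_Suc numeral_2_eq_2)
  ultimately have "expected_lis (decreasing_perm m) n = (\<Sum>\<sigma>\<in>?A. real (lis_length \<sigma>)) / real (card ?A)"
    unfolding expected_lis_def by (rule integral_pmf_of_set[rotated])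
  also have "card ?A = tree_count (m - 1) n"
    unfolding A tree_count_def by (rule card_image[OF inj])
  also have "(\<Sum>\<sigma>\<in>?A. real (lis_length \<sigma>)) = real (tree_inc_sum (m - 1) n)"
    unfolding A sum.reindex[OF inj] by (simp add: lis_length_tree_perm tree_inc_sum_def)
  finally show ?thesis .
qed

section \<open>Generating functions\<close>

definition count_fps :: "nat \<Rightarrow> real fps" where
  "count_fps k = Abs_fps (\<lambda>n. real (tree_count k n))"

definition inc_fps :: "nat \<Rightarrow> real fps" where
  "inc_fps k = Abs_fps (\<lambda>n. real (tree_inc_sum k n))"

text \<open>The polynomials \<open>P_k\<close> of the overview: the denominators of the continued
  fraction generated by \<open>C_k = 1 / (1 - x C_(k-1))\<close>.\<close>

fun height_poly :: "nat \<Rightarrow> real poly" where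
  "height_poly 0 = 1"
| "height_poly (Suc 0) = 1"
| "height_poly (Suc (Suc k)) = height_poly (Suc k) - [:0, 1:] * height_poly k"

definition inc_poly :: "nat \<Rightarrow> real poly" where
  "inc_poly k = (\<Sum>j=1..k. [:0, 1:] ^ (Suc k - j) * height_poly j ^ 2)"

lemma count_fps_0: "count_fps 0 = 1"
proof (rule fps_ext)
  fix n show "count_fps 0 $ n = 1 $ n"
    by (cases n) (auto simp: count_fps_def tree_count_0)
qed

lemma inc_fps_0: "inc_fps 0 = 0"
  by (rule fps_ext) (simp add: inc_fps_def tree_inc_sum_0)

lemma count_fps_Suc: "count_fps (Suc k) = 1 + fps_X * (count_fps k * count_fps (Suc k))"
proof (rule fps_ext)
  fix n
  have "(count_fps k * count_fps (Suc k)) $ i = real (tree_count (Suc k) (Suc i))" for i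
    by (simp add: fps_mult_nth atLeast0AtMost count_fps_def tree_count_Suc)
  then show "count_fps (Suc k) $ n = (1 + fps_X * (count_fps k * count_fps (Suc k))) $ n"
    by (cases n) (simp_all add: count_fps_def tree_count_0)
qed

lemma inc_fps_Suc:
  "inc_fps (Suc k) =
    fps_X * ((inc_fps k + 1) * count_fps (Suc k) + count_fps k * inc_fps (Suc k))"
proof (rule fps_ext)
  fix n
  have 1: "(inc_fps k + 1) $ i = real (tree_inc_sum k i + of_bool (i = 0))" for i
    by (simp add: inc_fps_def)
  have "((inc_fps k + 1) * count_fps (Suc k) + count_fps k * inc_fps (Suc k)) $ i =
      real (tree_inc_sum (Suc k) (Suc i))" for i
    unfolding fps_add_nth[of "_ * _"] fps_mult_nth 1 atLeast0AtMost
    by (simp add: count_fps_def inc_fps_def tree_inc_sum_Suc sum.distrib)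
  then show "inc_fps (Suc k) $ n =
    (fps_X * ((inc_fps k + 1) * count_fps (Suc k) + count_fps k * inc_fps (Suc k))) $ n"
    by (cases n) (simp_all add: inc_fps_def tree_inc_sum_0)
qed

lemma fps_height_poly_Suc_Suc:
  "fps_of_poly (height_poly (Suc (Suc k))) =
    fps_of_poly (height_poly (Suc k)) - fps_X * fps_of_poly (height_poly k)"
  by (simp only: height_poly.simps fps_of_poly_diff fps_of_poly_mult fps_of_poly_fps_X)

text \<open>By induction \<open>P_(k+2) = P_(k+1) (1 - x C_k)\<close>, while the recurrence says
  \<open>C_(k+1) (1 - x C_k) = 1\<close>.\<close>

lemma count_fps_height_poly:
  "count_fps k * fps_of_poly (height_poly (Suc k)) = fps_of_poly (height_poly k)"
proof (induction k)
  case 0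
  show ?case by (simp add: count_fps_0)
next
  case (Suc k)
  let ?F = "\<lambda>k. fps_of_poly (height_poly k)" and ?C = "count_fps k" and ?C' = "count_fps (Suc k)"
  have "?F (Suc (Suc k)) = ?F (Suc k) * (1 - fps_X * ?C)"
    unfolding fps_height_poly_Suc_Suc Suc.IH[symmetric] by (simp add: algebra_simps)
  then have "?C' * ?F (Suc (Suc k)) = ?F (Suc k) * (?C' - fps_X * (?C * ?C'))"
    by (simp only:) (simp add: algebra_simps)
  also have "?C' - fps_X * (?C * ?C') = 1"
    by (subst count_fps_Suc) simp
  finally show ?case by simp
qed

lemma inc_poly_Suc: "inc_poly (Suc k) = [:0, 1:] * (inc_poly k + height_poly (Suc k) ^ 2)"
proof -
  have "[:0, 1:] * inc_poly k = (\<Sum>j=1..k. [:0, 1:] ^ (Suc (Suc k) - j) * height_poly j ^ 2)"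
    unfolding inc_poly_def sum_distrib_left
    by (intro sum.cong refl) (simp only: atLeastAtMost_iff Suc_diff_le le_SucI power_Suc mult.assoc)
  then show ?thesis
    unfolding inc_poly_def[of "Suc k"] by (simp only: sum.cl_ivl_Suc distrib_left) simp
qed

text \<open>Of the two factors \<open>P_(k+2)\<close>, one is written as
  \<open>P_(k+1) (1 - x C_k)\<close>, which isolates \<open>B_(k+1)\<close> in its recurrence; the
  other turns the resulting \<open>C_(k+1)\<close> into \<open>P_(k+1)\<close>.\<close>

lemma inc_fps_height_poly:
  "inc_fps k * fps_of_poly (height_poly (Suc k)) ^ 2 = fps_of_poly (inc_poly k)"
proof (induction k)
  case 0
  show ?case by (simp add: inc_fps_0 inc_poly_def)
next
  case (Suc k)
  let ?F = "\<lambda>k. fps_of_poly (height_poly k)" and ?C = "count_fps k" and ?C' = "count_fps (Suc k)"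
  let ?B = "inc_fps k" and ?B' = "inc_fps (Suc k)"
  have F: "?F (Suc (Suc k)) = ?F (Suc k) * (1 - fps_X * ?C)"
    unfolding fps_height_poly_Suc_Suc count_fps_height_poly[symmetric, of k]
    by (simp add: algebra_simps)
  have B: "?B' * (1 - fps_X * ?C) = fps_X * ((?B + 1) * ?C')"
    using inc_fps_Suc[of k] by (simp add: algebra_simps)
  have "?B' * ?F (Suc (Suc k)) ^ 2 = (?B' * (1 - fps_X * ?C)) * ?F (Suc k) * ?F (Suc (Suc k))"
    by (simp only: power2_eq_square) (simp only: F mult_ac)
  also have "\<dots> = fps_X * (?B + 1) * ?F (Suc k) * (?C' * ?F (Suc (Suc k)))"
    unfolding B by (simp only: mult_ac)
  also have "\<dots> = fps_X * (?B * ?F (Suc k) ^ 2 + ?F (Suc k) ^ 2)"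
    unfolding count_fps_height_poly by (simp add: algebra_simps power2_eq_square)
  also have "\<dots> = fps_of_poly (inc_poly (Suc k))"
    unfolding Suc.IH inc_poly_Suc
    by (simp only: fps_of_poly_mult fps_of_poly_add fps_of_poly_fps_X fps_of_poly_power)
  finally show ?case .
qed

section \<open>Chebyshev factorization of the denominator\<close>

text \<open>The weight \<open>(2 * x) ^ j\<close> turns the recurrence of \<open>height_poly\<close>
  at \<open>1 / (4 * x^2)\<close> into that of the Chebyshev polynomials, since the square of
  \<open>2 * x\<close> cancels the argument.\<close>

lemma poly_height_poly:
  assumes "x \<noteq> 0"
  shows "poly (height_poly j) (1 / (4 * x\<^sup>2)) * (2 * x) ^ j = chebyshev_U j x"
proof (induction j rule: height_poly.induct)
  case (3 k)
  let ?p = "\<lambda>k. poly (height_poly k) (1 / (4 * x\<^sup>2))"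
  have *: "?p (Suc (Suc k)) * (2 * x) ^ Suc (Suc k) =
    2 * x * (?p (Suc k) * (2 * x) ^ Suc k) - ?p k * (2 * x) ^ k"
    using assms by (simp add: field_simps power2_eq_square)
  show ?case unfolding * 3 by simp
qed auto

text \<open>The Chebyshev recurrence is the addition formula for the sine. The form without division
  also covers \<open>sin \<theta> = 0\<close>.\<close>

lemma chebyshev_U_cos: "chebyshev_U j (cos \<theta>) * sin \<theta> = sin (real (Suc j) * \<theta>)"
proof (induction j rule: height_poly.induct)
  case 2
  show ?case by (simp add: sin_double)
next
  case (3 k)
  let ?s = "real (Suc (Suc k)) * \<theta>"
  have "chebyshev_U (Suc (Suc k)) (cos \<theta>) * sin \<theta> =
    2 * cos \<theta> * sin ?s - sin (?s - \<theta>)"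
    using 3 by (simp add: algebra_simps)
  also have "\<dots> = sin (?s + \<theta>)" by (simp add: sin_add sin_diff)
  finally show ?case by (simp add: algebra_simps)
qed auto

lemma degree_height_poly: "degree (height_poly k) \<le> k div 2"
proof (induction k rule: height_poly.induct)
  case (3 k)
  have "degree ([:0, 1:] * height_poly k) \<le> Suc (k div 2)"
    using degree_mult_le[of "[:0, 1:]" "height_poly k"] 3 by simp
  then show ?case using 3 unfolding height_poly.simps by (intro degree_diff_le) auto
qed auto

lemma poly_height_poly_0: "poly (height_poly k) 0 = 1"
  by (induction k rule: height_poly.induct) auto

lemma cos_angle_pos:
  assumes "1 \<le> j" "j \<le> m div 2"
  shows "cos (real j * pi / (real m + 1)) > 0"
proof (rule cos_gt_zero_pi)
  have "2 * real j < real m + 1" using assms by linarith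
  then have "pi * (2 * real j) < pi * (real m + 1)" by (intro mult_strict_left_mono) auto
  then show "real j * pi / (real m + 1) < pi / 2" by (simp add: field_simps)
  have "real j * pi / (real m + 1) \<ge> 0" by simp
  then show "- (pi / 2) < real j * pi / (real m + 1)" using pi_gt_zero by linarith
qed

lemma cos_angle_less:
  assumes "i < j" "j \<le> m"
  shows "cos (real j * pi / (real m + 1)) < cos (real i * pi / (real m + 1))"
proof (rule cos_monotone_0_pi)
  show "real i * pi / (real m + 1) < real j * pi / (real m + 1)"
    using assms by (intro divide_strict_right_mono mult_strict_right_mono) auto
  have "pi * real j \<le> pi * (real m + 1)" using assms by (intro mult_left_mono) auto
  then show "real j * pi / (real m + 1) \<le> pi" by (simp add: field_simps)
qed simp

text \<open>Both sides have degree at most \<open>m div 2\<close> and agree at more points than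
  that: at 0, where both are 1, and at the common zeros \<open>1 / (4 * (d j)^2)\<close>. These are
  distinct because the cosines involved are positive and strictly decreasing in
  \<open>j\<close>.\<close>

lemma height_poly_eq_prod:
  "height_poly m = (\<Prod>j=1..m div 2. [:1, - (4 * (cos (real j * pi / (real m + 1)))\<^sup>2):])"
proof -
  define d where "d = (\<lambda>j. cos (real j * pi / (real m + 1)))"
  define A where "A = insert 0 ((\<lambda>j. 1 / (4 * (d j)\<^sup>2)) ` {1..m div 2})"
  have pos: "d j > 0" if "j \<in> {1..m div 2}" for j
    using that cos_angle_pos[of j m] by (simp add: d_def)
  have "inj_on d {1..m div 2}"
    by (rule linorder_inj_onI) (auto simp: d_def dest!: cos_angle_less[of _ _ m])
  then have inj: "inj_on (\<lambda>j. 1 / (4 * (d j)\<^sup>2)) {1..m div 2}"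
  proof (intro inj_onI)
    fix i j assume ij: "i \<in> {1..m div 2}" "j \<in> {1..m div 2}"
      and "1 / (4 * (d i)\<^sup>2) = 1 / (4 * (d j)\<^sup>2)"
    then have "(d i)\<^sup>2 = (d j)\<^sup>2" by simp
    then have "d i = d j" using pos[OF ij(1)] pos[OF ij(2)] by (simp add: power2_eq_iff)
    from \<open>inj_on d {1..m div 2}\<close> this ij show "i = j" by (rule inj_onD)
  qed
  have "card A = Suc (card ((\<lambda>j. 1 / (4 * (d j)\<^sup>2)) ` {1..m div 2}))"
    unfolding A_def by (rule card_insert_disjoint) (use pos in force)+
  also have "\<dots> = Suc (m div 2)" unfolding card_image[OF inj] by simp
  finally have card: "card A = Suc (m div 2)" .
  have root: "poly (height_poly m) (1 / (4 * (d j)\<^sup>2)) = 0" if j: "j \<in> {1..m div 2}" for j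
  proof -
    have "chebyshev_U m (d j) * sin (real j * pi / (real m + 1)) = sin (real j * pi)"
    proof -
      have nz: "real m + 1 \<noteq> 0" by linarith
      show ?thesis unfolding d_def chebyshev_U_cos
        by (simp only: of_nat_Suc add.commute[of 1] times_divide_eq_right
            nonzero_mult_div_cancel_left[OF nz])
    qed
    moreover have "sin (real j * pi / (real m + 1)) > 0"
    proof (rule sin_gt_zero)
      have "real j < real m + 1" using j by auto
      then have "pi * real j < pi * (real m + 1)" by (intro mult_strict_left_mono) auto
      then show "real j * pi / (real m + 1) < pi" by (simp add: field_simps)
    qed (use j in auto)
    ultimately have "chebyshev_U m (d j) = 0" by (simp add: sin_npi)
    then show ?thesis using poly_height_poly[of "d j" m] pos[OF j] by simp
  qed
  have "height_poly m = (\<Prod>j=1..m div 2. [:1, - (4 * (d j)\<^sup>2):])"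
  proof (rule poly_eqI_degree)
    fix x assume "x \<in> A"
    then consider "x = 0" | j where "j \<in> {1..m div 2}" "x = 1 / (4 * (d j)\<^sup>2)"
      unfolding A_def by blast
    then show "poly (height_poly m) x = poly (\<Prod>j=1..m div 2. [:1, - (4 * (d j)\<^sup>2):]) x"
    proof cases
      case 1
      then show ?thesis by (simp add: poly_height_poly_0 poly_prod)
    next
      case (2 j)
      have "(\<Prod>i=1..m div 2. 1 + x * - (4 * (d i)\<^sup>2)) = 0"
        using 2 pos[OF 2(1)] by (intro prod_zero bexI[of _ j]) auto
      then show ?thesis using root[OF 2(1)] 2(2) by (simp add: poly_prod)
    qed
  next
    show "degree (height_poly m) < card A" using degree_height_poly[of m] card by simp
    have "degree (\<Prod>j=1..m div 2. [:1, - (4 * (d j)\<^sup>2):]) \<le>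
        (\<Sum>j=1..m div 2. degree [:1, - (4 * (d j)\<^sup>2):])"
      using degree_prod_sum_le[of "{1..m div 2}" "\<lambda>j. [:1, - (4 * (d j)\<^sup>2):]"] by (simp add: o_def)
    also have "\<dots> \<le> (\<Sum>j=1..m div 2. 1)" by (intro sum_mono) simp
    finally show "degree (\<Prod>j=1..m div 2. [:1, - (4 * (d j)\<^sup>2):]) < card A"
      using card by simp
  qed
  then show ?thesis by (simp add: d_def)
qed

section \<open>Coefficient asymptotics at a real pole\<close>

lemma fps_conv_radius_geometric:
  fixes a r :: real
  assumes "\<bar>a\<bar> < r"
  shows "fps_conv_radius (Abs_fps (\<lambda>n. a ^ n)) > ereal (1 / r)"
proof -
  \<comment> \<open>The reciprocal of the midpoint of \<open>\<bar>a\<bar>\<close> and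
    \<open>r\<close>, hence beyond \<open>1 / r\<close> but inside the disc of convergence; this
    also handles \<open>a = 0\<close>.\<close>
  define z where "z = 2 / (\<bar>a\<bar> + r)"
  have z: "z > 0" "\<bar>a * z\<bar> < 1" "1 / r < z"
    using assms by (auto simp: z_def abs_mult field_simps)
  have "summable (\<lambda>n. (a * z) ^ n)" using z by (intro summable_geometric) simp
  then have "ereal (norm z) \<le> fps_conv_radius (Abs_fps (\<lambda>n. a ^ n))"
    unfolding fps_conv_radius_def by (intro conv_radius_geI) (simp add: power_mult_distrib)
  moreover have "ereal (1 / r) < ereal (norm z)" using z by simp
  ultimately show ?thesis by (rule less_le_trans[rotated])
qed

lemma fps_of_poly_linear_factor: "fps_of_poly [:1, - a:] = 1 - fps_const a * (fps_X :: real fps)"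
proof (rule fps_ext)
  fix n show "fps_of_poly [:1, - a:] $ n = (1 - fps_const a * (fps_X :: real fps)) $ n"
    by (auto simp: coeff_pCons split: nat.split)
qed

lemma fps_geometric_mult: "Abs_fps (\<lambda>n. a ^ n) * fps_of_poly [:1, - a:] = (1 :: real fps)"
proof -
  let ?g = "Abs_fps (\<lambda>n. a ^ n)"
  have "?g - fps_const a * (fps_X * ?g) = 1"
  proof (rule fps_ext)
    fix n show "(?g - fps_const a * (fps_X * ?g)) $ n = 1 $ n"
      by (cases n) auto
  qed
  then show ?thesis
    by (simp only: fps_of_poly_linear_factor right_diff_distrib mult_1_left mult_1_right mult_ac)
qed

lemma fps_conv_radius_mult_less:
  assumes "z < fps_conv_radius f" "z < fps_conv_radius g"
  shows "z < fps_conv_radius (f * g)"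
  using assms fps_conv_radius_mult[of f g] by (meson less_le_trans min_less_iff_conj)

text \<open>The inverse is a product of geometric series, each converging beyond
  \<open>1 / r\<close>. It serves to cancel all factors of the denominator except that of the
  dominant pole.\<close>

lemma prod_linear_inverse_fps:
  fixes a :: "'b \<Rightarrow> real"
  assumes "finite A" "\<And>j. j \<in> A \<Longrightarrow> \<bar>a j\<bar> < r"
  shows "\<exists>g. g * fps_of_poly (\<Prod>j\<in>A. [:1, - a j:]) = 1 \<and> fps_conv_radius g > ereal (1 / r)"
  using assms
proof (induction A rule: finite_induct)
  case empty
  show ?case by (intro exI[of _ 1]) auto
next
  case (insert j A)
  then obtain g where g: "g * fps_of_poly (\<Prod>j\<in>A. [:1, - a j:]) = 1"
    "fps_conv_radius g > ereal (1 / r)" by auto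
  define h where "h = Abs_fps (\<lambda>n. a j ^ n)"
  have "(h * g) * fps_of_poly (\<Prod>j\<in>insert j A. [:1, - a j:]) =
      (h * fps_of_poly [:1, - a j:]) * (g * fps_of_poly (\<Prod>j\<in>A. [:1, - a j:]))"
    unfolding prod.insert[OF insert.hyps] fps_of_poly_mult by (simp only: mult_ac)
  also have "\<dots> = 1" unfolding h_def fps_geometric_mult g(1) by simp
  finally have "(h * g) * fps_of_poly (\<Prod>j\<in>insert j A. [:1, - a j:]) = 1" .
  moreover have "fps_conv_radius (h * g) > ereal (1 / r)"
    unfolding h_def
    by (intro fps_conv_radius_mult_less fps_conv_radius_geometric g) (use insert.prems in auto)
  ultimately show ?case by blast
qed

text \<open>Comparing coefficients gives \<open>f_(n+1) = g_(n+1) - r g_n\<close>; after division by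
  \<open>r^(n+1)\<close> this telescopes to the partial sums of \<open>f\<close> at
  \<open>1 / r\<close>.\<close>

lemma fps_nth_simple_pole:
  fixes r :: real
  assumes "r > 0" "f = g * fps_of_poly [:1, - r:]"
  shows "g $ n / r ^ n = (\<Sum>k\<le>n. f $ k / r ^ k)"
proof (induction n)
  case 0
  show ?case by (simp add: assms)
next
  case (Suc n)
  have "f = g - fps_const r * (fps_X * g)"
    by (simp add: assms fps_of_poly_linear_factor algebra_simps)
  then have "f $ Suc n = g $ Suc n - r * g $ n" by simp
  then show ?case using Suc.IH[symmetric] assms(1) by (simp add: field_simps)
qed

lemma fps_nth_simple_pole_limit:
  fixes r :: real
  assumes "r > 0" "f = g * fps_of_poly [:1, - r:]" "fps_conv_radius f > ereal (1 / r)"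
  shows "(\<lambda>n. g $ n / r ^ n) \<longlonglongrightarrow> eval_fps f (1 / r)"
proof -
  have "summable (\<lambda>n. f $ n * (1 / r) ^ n)"
    using assms by (intro summable_fps) simp
  from summable_LIMSEQ'[OF this] show ?thesis
    unfolding eval_fps_def fps_nth_simple_pole[OF assms(1,2)] by (simp add: power_one_over)
qed

lemma cesaro_mean_zero:
  fixes y :: "nat \<Rightarrow> real"
  assumes "y \<longlonglongrightarrow> 0"
  shows "(\<lambda>n. (\<Sum>k\<le>n. y k) / real n) \<longlonglongrightarrow> 0"
proof (rule LIMSEQ_I)
  fix e :: real assume e: "e > 0"
  \<comment> \<open>Since \<open>n + 1 \<le> 2 n\<close>, the tail costs at most half of
    \<open>n e\<close>; the choice of \<open>K\<close> keeps the fixed head \<open>M\<close> below a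
    further quarter.\<close>
  then obtain N where N: "\<bar>y k\<bar> < e / 4" if "k \<ge> N" for k
    using LIMSEQ_D[OF assms, of "e / 4"] by auto
  define M where "M = (\<Sum>k<N. \<bar>y k\<bar>)"
  have M: "M \<ge> 0" unfolding M_def by (intro sum_nonneg) auto
  obtain K where K: "real K > 4 * M / e" using reals_Archimedean2 by blast
  show "\<exists>n0. \<forall>n\<ge>n0. norm ((\<Sum>k\<le>n. y k) / real n - 0) < e"
  proof (intro exI[of _ "max 1 (max N K)"] allI impI)
    fix n assume n: "max 1 (max N K) \<le> n"
    have "\<bar>\<Sum>k\<le>n. y k\<bar> \<le> (\<Sum>k\<le>n. \<bar>y k\<bar>)" by (rule sum_abs)
    also have "\<dots> = M + (\<Sum>k=N..n. \<bar>y k\<bar>)"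
    proof -
      have split: "{..n} = {..<N} \<union> {N..n}" using n by auto
      show ?thesis unfolding M_def split by (rule sum.union_disjoint) auto
    qed
    also have "(\<Sum>k=N..n. \<bar>y k\<bar>) \<le> (\<Sum>k=N..n. e / 4)"
      by (intro sum_mono) (use N less_imp_le in auto)
    also have "\<dots> \<le> real (n + 1) * (e / 4)"
      unfolding sum_constant card_atLeastAtMost by (intro mult_right_mono of_nat_mono) (use e in auto)
    finally have 1: "\<bar>\<Sum>k\<le>n. y k\<bar> \<le> M + real (n + 1) * (e / 4)" by simp
    have "4 * M / e < real n" using K n by linarith
    then have "M < real n * e / 4" using e by (simp add: field_simps)
    moreover have "real (n + 1) * (e / 4) \<le> (2 * real n) * (e / 4)"
      using n e by (intro mult_right_mono) auto
    moreover have "0 < real n * e" using n e by simp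
    ultimately have "\<bar>\<Sum>k\<le>n. y k\<bar> < real n * e" using 1 by linarith
    then show "norm ((\<Sum>k\<le>n. y k) / real n - 0) < e" using n by (simp add: field_simps)
  qed
qed

text \<open>The sum has \<open>n + 1\<close> terms but is divided by \<open>n\<close>, so the
  constant part contributes \<open>(n + 1) / n * L\<close>, which still tends to
  \<open>L\<close>.\<close>

lemma cesaro_mean:
  fixes x :: "nat \<Rightarrow> real"
  assumes "x \<longlonglongrightarrow> L"
  shows "(\<lambda>n. (\<Sum>k\<le>n. x k) / real n) \<longlonglongrightarrow> L"
proof -
  have "(\<lambda>n. (\<Sum>k\<le>n. x k - L) / real n) \<longlonglongrightarrow> 0"
    by (rule cesaro_mean_zero) (use assms LIM_zero in auto)
  moreover have "(\<lambda>n. real (Suc n) / real n * L) \<longlonglongrightarrow> 1 * L"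
    by (intro tendsto_mult LIMSEQ_Suc_n_over_n tendsto_const)
  ultimately have "(\<lambda>n. (\<Sum>k\<le>n. x k - L) / real n + real (Suc n) / real n * L) \<longlonglongrightarrow> 0 + 1 * L"
    by (rule tendsto_add)
  \<comment> \<open>This includes \<open>n = 0\<close>, where division by zero makes both sides
    0.\<close>
  moreover have "(\<Sum>k\<le>n. x k - L) / real n + real (Suc n) / real n * L = (\<Sum>k\<le>n. x k) / real n" for n
    by (simp add: sum_subtractf add_divide_distrib diff_divide_distrib algebra_simps)
  ultimately show ?thesis by simp
qed

text \<open>Cancelling one factor leaves a series \<open>h\<close> with a simple pole, whose scaled
  coefficients converge. Those of \<open>g\<close> are their partial sums, so dividing by
  \<open>n\<close> gives Cesaro means with the same limit.\<close>

lemma fps_nth_double_pole_limit: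
  fixes r :: real
  assumes "r > 0" "f = g * fps_of_poly [:1, - r:] ^ 2" "fps_conv_radius f > ereal (1 / r)"
  shows "(\<lambda>n. g $ n / r ^ n / real n) \<longlonglongrightarrow> eval_fps f (1 / r)"
proof -
  define h where "h = g * fps_of_poly [:1, - r:]"
  have "f = h * fps_of_poly [:1, - r:]"
    by (simp add: assms(2) h_def power2_eq_square mult.assoc)
  then have "(\<lambda>n. h $ n / r ^ n) \<longlonglongrightarrow> eval_fps f (1 / r)"
    using assms by (intro fps_nth_simple_pole_limit)
  from cesaro_mean[OF this] show ?thesis
    by (simp only: fps_nth_simple_pole[OF assms(1) h_def])
qed

section \<open>The constant\<close>

text \<open>With \<open>\<theta> = pi / (m + 1)\<close>, the angle \<open>m \<theta>\<close> is
  \<open>pi - \<theta>\<close> and has the same sine as \<open>\<theta>\<close>.\<close>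

lemma chebyshev_U_cos_pred:
  assumes "m \<ge> 2"
  shows "chebyshev_U (m - 1) (cos (pi / (real m + 1))) = 1"
proof -
  define \<theta> where "\<theta> = pi / (real m + 1)"
  have "real (Suc (m - 1)) * \<theta> = pi - \<theta>" using assms by (simp add: \<theta>_def field_simps)
  then have "chebyshev_U (m - 1) (cos \<theta>) * sin \<theta> = sin \<theta>" by (simp add: chebyshev_U_cos)
  moreover have "sin \<theta> > 0" by (intro sin_gt_zero) (use assms in \<open>auto simp: \<theta>_def field_simps\<close>)
  ultimately show ?thesis by (simp add: \<theta>_def)
qed

text \<open>The reflection of \<open>j\<close> to \<open>m + 1 - j\<close> changes the sign of the
  cosine, so the factors pair up to \<open>c^2 - (d j)^2\<close>. For odd \<open>m\<close> the
  middle cosine vanishes and leaves a single factor \<open>c\<close>.\<close>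

lemma prod_cos_angle:
  fixes c :: real
  assumes m: "m \<ge> 2" and c: "c > 0"
  defines "d \<equiv> (\<lambda>j. cos (real j * pi / (real m + 1)))"
  shows "(\<Prod>j=2..m - 1. c - d j) = c ^ (m - 2) * (\<Prod>j=2..m div 2. 1 - (d j)\<^sup>2 / c\<^sup>2)"
proof -
  have refl: "d (m + 1 - j) = - d j" if "j \<le> m" for j
  proof -
    have "real (m + 1 - j) * pi / (real m + 1) = pi - real j * pi / (real m + 1)"
      using that by (simp add: of_nat_diff field_simps)
    then show ?thesis unfolding d_def by simp
  qed
  define h where "h = m div 2"
  have h: "h \<ge> 1" using m unfolding h_def by linarith
  have low: "(\<Prod>j=m + 2 - Suc h..m - 1. c - d j) = (\<Prod>j=2..h. c + d j)"
  proof (rule prod.reindex_bij_witness[where i = "\<lambda>j. m + 1 - j" and j = "\<lambda>j. m + 1 - j"])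
    fix j assume "j \<in> {m + 2 - Suc h..m - 1}"
    then have "j \<le> m" by auto
    then show "c + d (m + 1 - j) = c - d j" using refl[of j] by simp
  qed (use m h_def in auto)
  have pair: "(\<Prod>j=2..h. c - d j) * (\<Prod>j=2..h. c + d j) = c ^ (2 * (h - 1)) * (\<Prod>j=2..h. 1 - (d j)\<^sup>2 / c\<^sup>2)"
  proof -
    have "(\<Prod>j=2..h. c - d j) * (\<Prod>j=2..h. c + d j) = (\<Prod>j=2..h. c\<^sup>2 * (1 - (d j)\<^sup>2 / c\<^sup>2))"
      unfolding prod.distrib[symmetric] using c
      by (intro prod.cong) (auto simp: field_simps power2_eq_square)
    also have "\<dots> = (c\<^sup>2) ^ (h - 1) * (\<Prod>j=2..h. 1 - (d j)\<^sup>2 / c\<^sup>2)"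
      by (simp add: prod.distrib)
    finally show ?thesis by (simp add: power_mult)
  qed
  show ?thesis
  proof (cases "even m")
    case True
    then have mh: "m = 2 * h" by (simp add: h_def)
    have "{2..m - 1} = {2..h} \<union> {m + 2 - Suc h..m - 1}" using mh h by auto
    then have "(\<Prod>j=2..m - 1. c - d j) = (\<Prod>j=2..h. c - d j) * (\<Prod>j=m + 2 - Suc h..m - 1. c - d j)"
      by (simp only:) (rule prod.union_disjoint, use mh in auto)
    moreover have "2 * (h - 1) = m - 2" using mh by simp
    ultimately show ?thesis using low pair by (simp add: h_def[symmetric])
  next
    case False
    then have mh: "m = 2 * h + 1" by (simp add: h_def odd_two_times_div_two_succ)
    have "d (h + 1) = 0" using refl[of "h + 1"] mh h by simp
    have "{2..m - 1} = {2..h} \<union> insert (h + 1) {m + 2 - Suc h..m - 1}" using mh h by auto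
    then have "(\<Prod>j=2..m - 1. c - d j) =
        (\<Prod>j=2..h. c - d j) * (\<Prod>j\<in>insert (h + 1) {m + 2 - Suc h..m - 1}. c - d j)"
      by (simp only:) (rule prod.union_disjoint, use mh in auto)
    also have "(\<Prod>j\<in>insert (h + 1) {m + 2 - Suc h..m - 1}. c - d j) =
        c * (\<Prod>j=m + 2 - Suc h..m - 1. c - d j)"
      using mh \<open>d (h + 1) = 0\<close> by (subst prod.insert) auto
    finally have "(\<Prod>j=2..m - 1. c - d j) = c * (c ^ (2 * (h - 1)) * (\<Prod>j=2..h. 1 - (d j)\<^sup>2 / c\<^sup>2))"
      using low pair by simp
    moreover have "m - 2 = Suc (2 * (h - 1))" using mh h by simp
    ultimately show ?thesis by (simp add: h_def[symmetric])
  qed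
qed

text \<open>In the summand for \<open>j\<close>, the power of \<open>2 * x\<close> splits in two:
  one part cancels the power of the argument, the other rescales the squared
  \<open>height_poly j\<close> to a squared Chebyshev value.\<close>

lemma poly_inc_poly:
  assumes "x \<noteq> 0"
  shows "poly (inc_poly k) (1 / (4 * x\<^sup>2)) * (2 * x) ^ (2 * Suc k) = (\<Sum>j=1..k. (chebyshev_U j x)\<^sup>2)"
proof -
  have aux: "a * p * z = u" if "z = b * e" "a * b = 1" "p * e = u" for a b e p u z :: real
  proof -
    have "a * p * z = (a * b) * (p * e)" unfolding that(1) by (simp only: mult_ac)
    then show ?thesis unfolding that(2,3) by simp
  qed
  have "(1 / (4 * x\<^sup>2)) ^ (Suc k - j) * (poly (height_poly j) (1 / (4 * x\<^sup>2)))\<^sup>2 * (2 * x) ^ (2 * Suc k)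
      = (chebyshev_U j x)\<^sup>2" if "j \<in> {1..k}" for j
  proof -
    have "(2 * x) ^ (2 * Suc k) = (2 * x) ^ (2 * (Suc k - j)) * (2 * x) ^ (2 * j)"
      unfolding power_add[symmetric]
      by (rule arg_cong[where f = "power (2 * x)"]) (use that in auto)
    moreover have "(1 / (4 * x\<^sup>2)) ^ (Suc k - j) * (2 * x) ^ (2 * (Suc k - j)) = 1"
      unfolding power_mult power_mult_distrib[symmetric] using assms by (simp add: power2_eq_square)
    moreover have "(poly (height_poly j) (1 / (4 * x\<^sup>2)))\<^sup>2 * (2 * x) ^ (2 * j) = (chebyshev_U j x)\<^sup>2"
      unfolding poly_height_poly[OF assms, of j, symmetric] power_even_eq power_mult_distrib ..
    ultimately show ?thesis by (rule aux)
  qed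
  then show ?thesis
    unfolding inc_poly_def poly_sum sum_distrib_right
    by (intro sum.cong) (simp_all add: poly_power)
qed

lemma expected_lis_limit:
  fixes c :: real
  assumes m: "m \<ge> 2" and c_def: "c = cos (pi / (real m + 1))"
  defines "K \<equiv> (\<Sum>j=1..m - 1. (chebyshev_U j c)\<^sup>2) /
      (2 ^ (m + 1) * c ^ 3 * chebyshev_U (m - 1) c *
        (\<Prod>j=2..m - 1. c - cos (real j * pi / (real m + 1))))"
  shows "(\<lambda>n. expected_lis (decreasing_perm m) n / real n) \<longlonglongrightarrow> K" "K \<noteq> 0"
proof -
  define d where "d = (\<lambda>j. cos (real j * pi / (real m + 1)))"
  define r where "r = 4 * c\<^sup>2"
  \<comment> \<open>The denominator \<open>height_poly m\<close> without its factor for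
    \<open>j = 1\<close>, which carries the dominant pole \<open>1 / r\<close>.\<close>
  define q where "q = (\<Prod>j=2..m div 2. [:1, - (4 * (d j)\<^sup>2):])"
  have c: "c > 0" using cos_angle_pos[of 1 m] m by (simp add: c_def)
  then have r: "r > 0" by (simp add: r_def)
  have d_less: "(d j)\<^sup>2 < c\<^sup>2" if "j \<in> {2..m div 2}" for j
    using that cos_angle_less[of 1 j m] cos_angle_pos[of j m] unfolding d_def c_def
    by (intro power_strict_mono) auto
  obtain g where g: "g * fps_of_poly q = 1" "fps_conv_radius g > ereal (1 / r)"
    using prod_linear_inverse_fps[of "{2..m div 2}" "\<lambda>j. 4 * (d j)\<^sup>2" r] d_less
    unfolding q_def by (auto simp: r_def)
  have h1: "1 \<le> m div 2" using m by linarith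
  have height: "height_poly m = [:1, - r:] * q"
    unfolding height_poly_eq_prod q_def r_def c_def d_def
    unfolding prod.atLeast_Suc_atMost[OF h1] Suc_1 by simp
  have Sm: "Suc (m - 1) = m" using m by simp

  \<comment> \<open>Multiplying by the inverse \<open>g\<close> of \<open>q\<close> removes the
    other poles, so the left sides of \<open>f1\<close> and \<open>f2\<close> converge at
    \<open>1 / r\<close>.\<close>
  have f1: "fps_of_poly (height_poly (m - 1)) * g = count_fps (m - 1) * fps_of_poly [:1, - r:]"
    unfolding count_fps_height_poly[symmetric] Sm height fps_of_poly_mult
    using g(1) by (simp only: mult_ac) simp
  have f2: "fps_of_poly (inc_poly (m - 1)) * (g * g) = inc_fps (m - 1) * fps_of_poly [:1, - r:] ^ 2"
  proof -
    have gq: "(g * fps_of_poly q) ^ 2 = 1" unfolding g(1) by simp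
    have "fps_of_poly (inc_poly (m - 1)) * (g * g) =
        inc_fps (m - 1) * fps_of_poly [:1, - r:] ^ 2 * (g * fps_of_poly q) ^ 2"
      unfolding inc_fps_height_poly[symmetric] Sm height fps_of_poly_mult
      by (simp only: power2_eq_square mult_ac)
    then show ?thesis unfolding gq by simp
  qed
  have lim1: "(\<lambda>n. count_fps (m - 1) $ n / r ^ n) \<longlonglongrightarrow>
      eval_fps (fps_of_poly (height_poly (m - 1)) * g) (1 / r)"
    by (rule fps_nth_simple_pole_limit[OF r f1]) (intro fps_conv_radius_mult_less g, simp)
  have lim2: "(\<lambda>n. inc_fps (m - 1) $ n / r ^ n / real n) \<longlonglongrightarrow>
      eval_fps (fps_of_poly (inc_poly (m - 1)) * (g * g)) (1 / r)"
    by (rule fps_nth_double_pole_limit[OF r f2]) (intro fps_conv_radius_mult_less g, simp)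
  define G where "G = eval_fps g (1 / r)"
  have norm: "ereal (norm (1 / r)) < fps_conv_radius g" using g(2) r by simp
  have gg: "ereal (norm (1 / r)) < fps_conv_radius (g * g)"
    by (intro fps_conv_radius_mult_less norm)
  have e1: "eval_fps (fps_of_poly (height_poly (m - 1)) * g) (1 / r) =
      poly (height_poly (m - 1)) (1 / r) * G"
    using norm by (subst eval_fps_mult) (auto simp: G_def)
  have e2: "eval_fps (fps_of_poly (inc_poly (m - 1)) * (g * g)) (1 / r) =
      poly (inc_poly (m - 1)) (1 / r) * (G * G)"
    using norm gg by (subst eval_fps_mult; (subst eval_fps_mult)?) (auto simp: G_def)
  have Gq: "G * poly q (1 / r) = 1"
    using eval_fps_mult[of "1 / r" g "fps_of_poly q"] norm by (simp add: G_def g(1))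
  define S where "S = (\<Sum>j=1..m - 1. (chebyshev_U j c)\<^sup>2)"
  have U1: "chebyshev_U (m - 1) c = 1" unfolding c_def by (rule chebyshev_U_cos_pred[OF m])
  have hp: "poly (height_poly (m - 1)) (1 / r) = 1 / (2 * c) ^ (m - 1)"
    using poly_height_poly[of c "m - 1"] c U1 by (simp add: r_def field_simps)
  have ip: "poly (inc_poly (m - 1)) (1 / r) = S / (2 * c) ^ (2 * m)"
    using poly_inc_poly[of c "m - 1"] c Sm unfolding S_def[symmetric] r_def by (simp add: field_simps)
  have qv: "poly q (1 / r) = (\<Prod>j=2..m div 2. 1 - (d j)\<^sup>2 / c\<^sup>2)"
    unfolding q_def r_def poly_prod by (intro prod.cong) (auto simp: field_simps)
  have qpos: "poly q (1 / r) > 0"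
    unfolding qv using d_less c by (intro prod_pos) (auto simp: field_simps)
  have prd: "(\<Prod>j=2..m - 1. c - cos (real j * pi / (real m + 1))) = c ^ (m - 2) * poly q (1 / r)"
    using prod_cos_angle[OF m c] unfolding qv d_def by simp
  have "(chebyshev_U 1 c)\<^sup>2 \<le> S"
    unfolding S_def using m by (intro member_le_sum) auto
  moreover have "(chebyshev_U 1 c)\<^sup>2 > 0" using c by simp
  ultimately have S: "S > 0" by linarith
  have K: "K = S / (2 ^ (m + 1) * c ^ 3 * (c ^ (m - 2) * poly q (1 / r)))"
    unfolding K_def prd U1 S_def by simp
  show "K \<noteq> 0" unfolding K using S c qpos by simp
  have G: "G = 1 / poly q (1 / r)" using Gq qpos by (simp add: field_simps)
  \<comment> \<open>Both sides equal \<open>S / ((2 * c) ^ (m + 1) * poly q (1 / r))\<close>; one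
    factor \<open>G\<close> cancels. Writing \<open>m = k + 2\<close> removes the truncated
    subtractions in the exponents.\<close>
  have val: "(poly (inc_poly (m - 1)) (1 / r) * (G * G)) / (poly (height_poly (m - 1)) (1 / r) * G) = K"
  proof -
    obtain k where k: "m = k + 2" using m le_Suc_ex by (metis add.commute)
    show ?thesis unfolding hp ip G K using c qpos S
      by (simp add: k field_simps power_add power_mult_distrib power_mult power2_eq_square power3_eq_cube)
  qed
  have nz: "eval_fps (fps_of_poly (height_poly (m - 1)) * g) (1 / r) \<noteq> 0"
    unfolding e1 hp G using c qpos by simp
  have "(\<lambda>n. (inc_fps (m - 1) $ n / r ^ n / real n) / (count_fps (m - 1) $ n / r ^ n)) \<longlonglongrightarrow> K"
    unfolding val[symmetric] e1[symmetric] e2[symmetric]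
    by (intro tendsto_divide lim1 lim2 nz)
  moreover have "(inc_fps (m - 1) $ n / r ^ n / real n) / (count_fps (m - 1) $ n / r ^ n) =
      expected_lis (decreasing_perm m) n / real n" for n
    using r by (simp add: expected_lis_eq[OF m] inc_fps_def count_fps_def)
  ultimately show "(\<lambda>n. expected_lis (decreasing_perm m) n / real n) \<longlonglongrightarrow> K" by simp
qed

theorem theorem3p5:
  fixes m :: nat and c :: real
  assumes "m \<ge> 2"
    and "c = cos (pi / (real m + 1))"
  shows "(\<lambda>n. expected_lis (decreasing_perm m) n) \<sim>[at_top]
    (\<lambda>n. (\<Sum>j=1..m - 1. (chebyshev_U j c)\<^sup>2) /
      (2 ^ (m + 1) * c ^ 3 * chebyshev_U (m - 1) c *
        (\<Prod>j=2..m - 1. c - cos (real j * pi / (real m + 1)))) * real n)"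
proof -
  let ?K = "(\<Sum>j=1..m - 1. (chebyshev_U j c)\<^sup>2) /
      (2 ^ (m + 1) * c ^ 3 * chebyshev_U (m - 1) c *
        (\<Prod>j=2..m - 1. c - cos (real j * pi / (real m + 1))))"
  note limit = expected_lis_limit[OF assms]
  \<comment> \<open>A nonzero limit is essential here: dividing by it gives a ratio tending to
    1.\<close>
  have "(\<lambda>n. expected_lis (decreasing_perm m) n / real n / ?K) \<longlonglongrightarrow> ?K / ?K"
    by (intro tendsto_divide limit tendsto_const)
  then show ?thesis
    using limit(2) by (intro asymp_equivI') (simp add: field_simps)
qed

end
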